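(* Let $C_1,C_2,\ldots,C_m,\mathcal S\subseteq\mathbb R^n$ be nonempty, closed and strictly convex sets. Assume that the collection $\{C_i\}_{i=1}^m$ is in general position with respect to the hub set $\mathcal S$, and that at least one of the sets $C_1,\ldots,C_m,\mathcal S$ is bounded. Furthermore, suppose that all interaction weights are strictly positive, that is, $\rho_i>0$ and $\omega_i>0$ for all $i=1,\ldots,m$. Then the Generalized Heron--Waist Problem $$\min_{(a_1,\ldots,a_m,x)\in\Omega} J(a_1,\ldots,a_m,x)$$ admits a unique optimal solution.
   Context: The space $\mathbb R^n$ carries the standard inner product and the induced Euclidean norm $\|\cdot\|$. The feasible set is $\Omega:=C_1\times C_2\times\cdots\times C_m\times\mathcal S\subset\mathbb R^{n(m+1)}$; a point of it is written $(a_1,\ldots,a_m,x)$ with $a_i\in C_i$ (the vertices of a closed polygonal chain) and $x\in\mathcal S$ (the hub). The objective is $$J(a_1,\ldots,a_m,x):=\sum_{i=1}^m\rho_i\|a_i-a_{i+1}\|+\sum_{i=1}^m\omega_i\|a_i-x\|,\qquad a_{m+1}:=a_1,$$ where $\rho_1,\ldots,\rho_m$ and $\omega_1,\ldots,\omega_m$ are the interaction weights. A set $C\subset\mathbb R^n$ is strictly convex if for any two distinct points $y,z\in C$ and any $\lambda\in(0,1)$, the point $\lambda y+(1-\lambda)z$ lies in the interior $\operatorname{int}(C)$. General position: for each $i\in\{1,\ldots,m\}$ let $K_i:=\operatorname{conv}\bigl(C_1\cup\cdots\cup C_{i-1}\cup C_{i+1}\cup\cdots\cup C_m\cup\mathcal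 S\bigr)$, where $\operatorname{conv}$ denotes the convex hull. The collection $\{C_i\}_{i=1}^m$ is in general position with respect to $\mathcal S$ if $C_i\cap K_i=\varnothing$ for all $i=1,\ldots,m$.
   Formalization: The formal theorem assumes m ≥ 3 (a genuine closed polygonal chain); for m = 2 uniqueness fails, e.g. C_1, C_2 unit balls centred at −10e_1 and 10e_1, S the unit ball at 0, all weights 1: every hub te_1 with |t| ≤ 1 is optimal. The one-vertex case m = 1 is not covered. *)

theory Defs
  imports "HOL-Analysis.Analysis"
begin

definition strictly_convex :: "(real ^ 'n) set \<Rightarrow> bool" where
  "strictly_convex C \<longleftrightarrow>
     (\<forall>y\<in>C. \<forall>z\<in>C. y \<noteq> z \<longrightarrow>
        (\<forall>t\<in>{0<..<1}. t *\<^sub>R y + (1 - t) *\<^sub>R z \<in> interior C))"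

definition hull_without ::
    "nat \<Rightarrow> (nat \<Rightarrow> (real ^ 'n) set) \<Rightarrow> (real ^ 'n) set \<Rightarrow> nat \<Rightarrow> (real ^ 'n) set" where
  "hull_without m C S i = convex hull ((\<Union>j\<in>{1..m} - {i}. C j) \<union> S)"

definition general_position ::
    "nat \<Rightarrow> (nat \<Rightarrow> (real ^ 'n) set) \<Rightarrow> (real ^ 'n) set \<Rightarrow> bool" where
  "general_position m C S \<longleftrightarrow> (\<forall>i\<in>{1..m}. C i \<inter> hull_without m C S i = {})"

(* The vertices are a function on the indices 1..m; the extensional product makes its
   value outside 1..m fixed, so that two feasible points are equal iff they have the same
   m vertices and the same hub. *)
definition feasible_set ::
    "nat \<Rightarrow> (nat \<Rightarrow> (real ^ 'n) set) \<Rightarrow> (real ^ 'n) set \<Rightarrow>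
     ((nat \<Rightarrow> real ^ 'n) \<times> (real ^ 'n)) set" where
  "feasible_set m C S = (\<Pi>\<^sub>E i\<in>{1..m}. C i) \<times> S"

(* The chain is closed up by the convention that vertex m + 1 is vertex 1. *)
definition next_vertex :: "nat \<Rightarrow> nat \<Rightarrow> nat" where
  "next_vertex m i = (if i = m then 1 else i + 1)"

definition heron_waist_objective ::
    "nat \<Rightarrow> (nat \<Rightarrow> real) \<Rightarrow> (nat \<Rightarrow> real) \<Rightarrow> (nat \<Rightarrow> real ^ 'n) \<times> (real ^ 'n) \<Rightarrow> real" where
  "heron_waist_objective m \<rho> \<omega> = (\<lambda>(a, x).
     (\<Sum>i=1..m. \<rho> i * norm (a i - a (next_vertex m i))) +
     (\<Sum>i=1..m. \<omega> i * norm (a i - x)))"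

end

theory Submission
  imports Defs
begin

text \<open>
  Existence holds because every spoke \<open>\<omega> i * norm (a i - x)\<close> is bounded by the objective: a sublevel
  set keeps all vertices within a fixed distance of the hub, so one bounded constraint set bounds
  them all, and the continuous objective attains its minimum on a compact box
  (\<open>heron_waist_minimizer_exists\<close>).

  Uniqueness combines three observations.  First, no vertex of a minimizer lies in the interior of
  its set (\<open>minimizer_vertex_notin_interior\<close>): by general position the vertex is outside the convex
  hull of the other vertices and the hub, and moving it slightly towards its projection on that hull
  brings it closer to all of these points at once.  Secondly, by convexity the midpoint of two
  minimizers is again a minimizer, and none of the triangle inequalities between corresponding
  spokes is strict (\<open>minimizer_midpoint\<close>).  If two minimizers differed at vertex \<open>i\<close>, strict
  convexity would put vertex \<open>i\<close> of the midpoint into the interior of \<open>C i\<close>, which the first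
  observation excludes; so they share all their vertices.  Finally, if the hubs \<open>x \<noteq> y\<close> differed,
  equality in the triangle inequality would place every vertex on the line through \<open>x\<close> and \<open>y\<close>.  Of
  three vertices on a line one lies between the two others, contrary to general position.
\<close>

section \<open>Geometric facts\<close>

lemma strictly_convex_midpoint_interior:
  fixes C :: "(real ^ 'n) set"
  assumes "strictly_convex C" "y \<in> C" "z \<in> C" "y \<noteq> z"
  shows "midpoint y z \<in> interior C"
proof -
  have "(1/2) *\<^sub>R y + (1 - 1/2) *\<^sub>R z \<in> interior C"
    using assms unfolding strictly_convex_def
    by (metis (no_types, lifting) greaterThanLessThan_iff half_gt_zero_iff zero_less_one
        field_sum_of_halves less_add_same_cancel1)
  then show ?thesis
    by (simp add: midpoint_def scaleR_add_right)
qed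

lemma strictly_convex_midpoint:
  fixes C :: "(real ^ 'n) set"
  assumes "strictly_convex C" "y \<in> C" "z \<in> C"
  shows "midpoint y z \<in> C"
  using strictly_convex_midpoint_interior[OF assms] interior_subset[of C] assms(2)
  by (cases "y = z") auto

text \<open>
  The angle at the projection is not acute, so in the triangle of the point, its projection and \<open>w\<close>
  the side opposite to the projection is strictly the longest.
\<close>
lemma closest_point_strictly_nearer:
  fixes c :: "'a::euclidean_space"
  assumes "convex H" "closed H" "c \<notin> H" "w \<in> H"
  shows "norm (closest_point H c - w) < norm (c - w)"
proof -
  define p where "p = closest_point H c"
  have "p \<in> H"
    unfolding p_def using assms by (intro closest_point_in_set) auto
  then have "c \<noteq> p"
    using assms(3) by auto
  then have "0 < (c - p) \<bullet> (c - p)"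
    by simp
  moreover have "(c - p) \<bullet> (w - p) \<le> 0"
    unfolding p_def using assms by (intro closest_point_dot)
  moreover have "(c - w) \<bullet> (c - w) =
      (c - p) \<bullet> (c - p) + (p - w) \<bullet> (p - w) - 2 * ((c - p) \<bullet> (w - p))"
    by (simp add: inner_diff inner_commute algebra_simps)
  ultimately have "(p - w) \<bullet> (p - w) < (c - w) \<bullet> (c - w)"
    by linarith
  then show ?thesis
    by (simp add: norm_lt p_def)
qed

text \<open>
  An interior point of \<open>C\<close> outside \<open>H\<close> can be moved within \<open>C\<close> so that its distances to all points
  of \<open>H\<close> decrease simultaneously: any small step towards the projection on \<open>H\<close> does this.
\<close>
lemma interior_point_moves_nearer:
  fixes c :: "'a::euclidean_space"
  assumes "c \<in> interior C" and H: "convex H" "closed H" "c \<notin> H"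
  obtains u where "u \<in> C" "\<And>w. w \<in> H \<Longrightarrow> norm (u - w) < norm (c - w)"
proof -
  define p where "p = closest_point H c"
  obtain e where e: "e > 0" "ball c e \<subseteq> C"
    using assms(1) by (meson mem_interior)
  \<comment> \<open>A step length for which both \<open>t < 1\<close> and \<open>t * norm (p - c) < e\<close>.\<close>
  define t where "t = e / (e + norm (p - c) + 1)"
  define u where "u = (1 - t) *\<^sub>R c + t *\<^sub>R p"
  have t: "0 < t" "t < 1"
    using e(1) norm_ge_zero[of "p - c"] by (auto simp: t_def field_simps add_pos_nonneg)
  have "t * norm (p - c) < e"
  proof -
    have "e * norm (p - c) < e * (e + norm (p - c) + 1)"
      using e(1) by (intro mult_strict_left_mono) auto
    moreover have "0 < e + norm (p - c) + 1"
      using e(1) by (simp add: add_pos_nonneg)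
    ultimately show ?thesis
      by (simp add: t_def field_simps)
  qed
  moreover have "u - c = t *\<^sub>R (p - c)"
    by (simp add: u_def algebra_simps)
  ultimately have "dist c u < e"
    using t by (simp add: dist_norm norm_minus_commute[of c u])
  then have "u \<in> C"
    using e(2) by auto
  moreover have "norm (u - w) < norm (c - w)" if "w \<in> H" for w
  proof -
    have "u - w = (1 - t) *\<^sub>R (c - w) + t *\<^sub>R (p - w)"
      by (simp add: u_def algebra_simps)
    then have "norm (u - w) \<le> (1 - t) * norm (c - w) + t * norm (p - w)"
      using t norm_triangle_ineq[of "(1 - t) *\<^sub>R (c - w)" "t *\<^sub>R (p - w)"] by simp
    also have "\<dots> < (1 - t) * norm (c - w) + t * norm (c - w)"
      using t closest_point_strictly_nearer[OF H that] by (simp add: p_def)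
    finally show ?thesis
      by (simp add: algebra_simps)
  qed
  ultimately show ?thesis
    using that by blast
qed

lemma norm_triangle_eq_imp_on_line:
  fixes a x y :: "'a::real_inner"
  assumes "x \<noteq> y" and eq: "norm ((a - x) + (a - y)) = norm (a - x) + norm (a - y)"
  shows "a \<in> affine hull {x, y}"
proof -
  define r s where "r = norm (a - x)" and "s = norm (a - y)"
  have par: "r *\<^sub>R (a - y) = s *\<^sub>R (a - x)"
    using eq unfolding r_def s_def norm_triangle_eq .
  have "r \<noteq> s"
  proof
    assume "r = s"
    with par have "r *\<^sub>R (x - y) = 0"
      by (simp add: algebra_simps)
    with \<open>x \<noteq> y\<close> \<open>r = s\<close> show False
      by (simp add: r_def s_def)
  qed
  have "(r - s) *\<^sub>R a = r *\<^sub>R y - s *\<^sub>R x"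
    using par by (simp add: algebra_simps)
  then have "a = (1 / (r - s)) *\<^sub>R (r *\<^sub>R y - s *\<^sub>R x)"
    using \<open>r \<noteq> s\<close> by (metis divide_self_if eq_iff_diff_eq_0 scaleR_one scaleR_scaleR
        times_divide_eq_left mult_1)
  then have "a = (- s / (r - s)) *\<^sub>R x + (r / (r - s)) *\<^sub>R y"
    by (simp add: scaleR_diff_right)
  moreover have "- s / (r - s) + r / (r - s) = 1"
  proof -
    have "- s / (r - s) + r / (r - s) = (r - s) / (r - s)"
      unfolding diff_divide_distrib by simp
    then show ?thesis
      using \<open>r \<noteq> s\<close> by simp
  qed
  ultimately show ?thesis
    unfolding affine_hull_2 by blast
qed

section \<open>Feasible points and the objective\<close>

lemma next_vertex_in_range:
  assumes "i \<in> {1..m}"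
  shows "next_vertex m i \<in> {1..m}"
  using assms by (auto simp: next_vertex_def)

lemma next_vertex_neq:
  assumes "m \<ge> 2"
  shows "next_vertex m i \<noteq> i"
  using assms by (auto simp: next_vertex_def)

lemma mem_feasible_set_iff:
  "(a, x) \<in> feasible_set m C S \<longleftrightarrow> a \<in> (\<Pi>\<^sub>E i\<in>{1..m}. C i) \<and> x \<in> S"
  by (simp add: feasible_set_def)

text \<open>General position with the other constraint sets replaced by a feasible choice of points.\<close>
lemma general_position_vertex_notin_hull:
  assumes "general_position m C S" "i \<in> {1..m}" "(a, x) \<in> feasible_set m C S"
  shows "a i \<notin> convex hull (insert x (a ` ({1..m} - {i})))"
proof -
  have "insert x (a ` ({1..m} - {i})) \<subseteq> (\<Union>j\<in>{1..m} - {i}. C j) \<union> S"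
    using assms(3) by (auto simp: mem_feasible_set_iff PiE_iff)
  then have "convex hull (insert x (a ` ({1..m} - {i}))) \<subseteq> hull_without m C S i"
    unfolding hull_without_def by (rule hull_mono)
  moreover have "a i \<in> C i"
    using assms(2,3) by (auto simp: mem_feasible_set_iff)
  ultimately show ?thesis
    using assms(1,2) unfolding general_position_def by blast
qed

lemma continuous_on_heron_waist_objective:
  "continuous_on A (heron_waist_objective m \<rho> \<omega>)"
proof -
  have coord: "continuous_on A (\<lambda>p :: (nat \<Rightarrow> real ^ 'n) \<times> (real ^ 'n). fst p i)"
    for i and A :: "((nat \<Rightarrow> real ^ 'n) \<times> (real ^ 'n)) set"
    by (rule continuous_on_product_then_coordinatewise) (intro continuous_intros)
  show ?thesis
    unfolding heron_waist_objective_def case_prod_beta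
    by (intro continuous_intros coord)
qed

lemma compact_feasible_set:
  assumes "\<And>i. i \<in> {1..m} \<Longrightarrow> compact (C i)" "compact S"
  shows "compact (feasible_set m C S)"
proof -
  define D where "D i = (if i \<in> {1..m} then C i else {undefined})" for i
  have "compactin (product_topology (\<lambda>i. euclidean) UNIV) (Pi\<^sub>E UNIV D)"
    using assms(1) by (auto simp: compactin_PiE D_def)
  then have "compact (Pi\<^sub>E UNIV D)"
    by (simp add: euclidean_product_topology)
  moreover have "Pi\<^sub>E UNIV D = (\<Pi>\<^sub>E i\<in>{1..m}. C i)"
    by (auto simp: D_def PiE_iff extensional_def split: if_splits)
  ultimately show ?thesis
    unfolding feasible_set_def using assms(2) by (simp add: compact_Times)
qed

lemma spoke_le_objective:
  assumes "\<forall>i\<in>{1..m}. \<rho> i > 0 \<and> \<omega> i > 0" "k \<in> {1..m}"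
  shows "\<omega> k * norm (a k - x) \<le> heron_waist_objective m \<rho> \<omega> (a, x)"
proof -
  have "\<omega> k * norm (a k - x) \<le> (\<Sum>i=1..m. \<omega> i * norm (a i - x))"
    using assms by (intro member_le_sum) (auto simp: less_imp_le)
  moreover have "0 \<le> (\<Sum>i=1..m. \<rho> i * norm (a i - a (next_vertex m i)))"
    using assms(1) by (intro sum_nonneg) (auto simp: less_imp_le)
  ultimately show ?thesis
    by (simp add: heron_waist_objective_def)
qed

section \<open>Existence of a minimizer\<close>

text \<open>
  Coercivity: a spoke of length at most \<open>R\<close> joins each vertex to the hub, hence any two of the points
  are at distance at most \<open>2 * R\<close>, and the bounded constraint set anchors one of them.
\<close>
lemma sublevel_set_bounded:
  assumes bdd: "(\<exists>i\<in>{1..m}. bounded (C i)) \<or> bounded S"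
    and pos: "\<forall>i\<in>{1..m}. \<rho> i > 0 \<and> \<omega> i > 0"
  obtains M where "\<And>a x. (a, x) \<in> feasible_set m C S \<Longrightarrow> heron_waist_objective m \<rho> \<omega> (a, x) \<le> L \<Longrightarrow>
      norm x \<le> M \<and> (\<forall>i\<in>{1..m}. norm (a i) \<le> M)"
proof -
  define R where "R = (\<Sum>i=1..m. \<bar>L\<bar> / \<omega> i)"
  have "0 \<le> R"
    unfolding R_def using pos by (intro sum_nonneg) (auto simp: less_imp_le)
  have spoke: "norm (a k - x) \<le> R"
    if le: "heron_waist_objective m \<rho> \<omega> (a, x) \<le> L" and k: "k \<in> {1..m}" for a x k
  proof -
    have "\<omega> k * norm (a k - x) \<le> \<bar>L\<bar>"
      using spoke_le_objective[OF pos k, of a x] le by linarith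
    then have "norm (a k - x) \<le> \<bar>L\<bar> / \<omega> k"
      using pos k by (simp add: pos_le_divide_eq mult.commute)
    also have "\<dots> \<le> R"
      unfolding R_def using pos k
      by (intro member_le_sum[where f = "\<lambda>i. \<bar>L\<bar> / \<omega> i"]) (auto simp: less_imp_le)
    finally show ?thesis .
  qed
  obtain B where hub: "\<And>a x. (a, x) \<in> feasible_set m C S \<Longrightarrow>
      heron_waist_objective m \<rho> \<omega> (a, x) \<le> L \<Longrightarrow> norm x \<le> B"
  proof -
    consider k where "k \<in> {1..m}" "bounded (C k)" | "bounded S"
      using bdd by blast
    then show ?thesis
    proof cases
      case 1
      then obtain B where B: "\<And>v. v \<in> C k \<Longrightarrow> norm v \<le> B"
        by (auto simp: bounded_iff)
      show ?thesis
      proof (rule that[of "B + R"])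
        fix a x
        assume "(a, x) \<in> feasible_set m C S" "heron_waist_objective m \<rho> \<omega> (a, x) \<le> L"
        then have "norm (a k) \<le> B" "norm (a k - x) \<le> R"
          using 1 B spoke by (auto simp: mem_feasible_set_iff PiE_iff)
        then show "norm x \<le> B + R"
          using norm_triangle_ineq4[of "a k" "a k - x"] by simp
      qed
    next
      case 2
      then show ?thesis
        using that by (auto simp: bounded_iff mem_feasible_set_iff)
    qed
  qed
  show ?thesis
  proof (rule that[of "B + R"])
    fix a x
    assume feas: "(a, x) \<in> feasible_set m C S" and le: "heron_waist_objective m \<rho> \<omega> (a, x) \<le> L"
    have "norm x \<le> B"
      using hub[OF feas le] .
    moreover have "norm (a i) \<le> norm x + R" if "i \<in> {1..m}" for i
      using norm_triangle_ineq[of x "a i - x"] spoke[OF le that] by simp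
    ultimately show "norm x \<le> B + R \<and> (\<forall>i\<in>{1..m}. norm (a i) \<le> B + R)"
      using \<open>0 \<le> R\<close> by force
  qed
qed

lemma heron_waist_minimizer_exists:
  fixes C :: "nat \<Rightarrow> (real ^ 'n) set"
  assumes C: "\<forall>i\<in>{1..m}. C i \<noteq> {} \<and> closed (C i)" and S: "S \<noteq> {}" "closed S"
    and bdd: "(\<exists>i\<in>{1..m}. bounded (C i)) \<or> bounded S"
    and pos: "\<forall>i\<in>{1..m}. \<rho> i > 0 \<and> \<omega> i > 0"
  shows "\<exists>p. is_arg_min (heron_waist_objective m \<rho> \<omega>) (\<lambda>p. p \<in> feasible_set m C S) p"
proof -
  let ?J = "heron_waist_objective m \<rho> \<omega> :: (nat \<Rightarrow> real ^ 'n) \<times> (real ^ 'n) \<Rightarrow> real"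
  have "(\<Pi>\<^sub>E i\<in>{1..m}. C i) \<noteq> {}"
    using C by (simp add: PiE_eq_empty_iff)
  then obtain p0 where p0: "p0 \<in> feasible_set m C S"
    using S(1) by (auto simp: feasible_set_def)
  obtain M where M: "\<And>a x. (a, x) \<in> feasible_set m C S \<Longrightarrow> ?J (a, x) \<le> ?J p0 \<Longrightarrow>
      norm x \<le> M \<and> (\<forall>i\<in>{1..m}. norm (a i) \<le> M)"
    using sublevel_set_bounded[OF bdd pos] by blast
  define K where "K = feasible_set m (\<lambda>i. C i \<inter> cball 0 M) (S \<inter> cball 0 M)"
  have K_sub: "K \<subseteq> feasible_set m C S"
    unfolding K_def feasible_set_def by (intro Sigma_mono PiE_mono) auto
  have K: "p \<in> K" if "p \<in> feasible_set m C S" "?J p \<le> ?J p0" for p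
  proof (cases p)
    case (Pair a x)
    with that M[of a x] show ?thesis
      by (auto simp: K_def mem_feasible_set_iff PiE_iff)
  qed
  have "compact K"
    unfolding K_def using C S(2) by (intro compact_feasible_set) (auto intro: closed_Int_compact)
  moreover have "K \<noteq> {}"
    using K[OF p0] by auto
  ultimately obtain p where p: "p \<in> K" "\<And>q. q \<in> K \<Longrightarrow> ?J p \<le> ?J q"
    using continuous_attains_inf[OF _ _ continuous_on_heron_waist_objective] by metis
  have "?J p \<le> ?J q" if "q \<in> feasible_set m C S" for q
    using p(2)[OF K[OF p0 order.refl]] p(2)[OF K[OF that]] by linarith
  then show ?thesis
    using p(1) K_sub unfolding is_arg_min_linorder by blast
qed

section \<open>Uniqueness of the minimizer\<close>

text \<open>
  Every term of the objective that involves vertex \<open>i\<close> is a distance to one of the points spanning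
  the hull of the remaining vertices and the hub, so the displacement of
  \<open>interior_point_moves_nearer\<close> lowers all of these terms and leaves the others unchanged.
\<close>
lemma minimizer_vertex_notin_interior:
  fixes C :: "nat \<Rightarrow> (real ^ 'n) set"
  assumes m: "m \<ge> 2" and gp: "general_position m C S"
    and pos: "\<forall>i\<in>{1..m}. \<rho> i > 0 \<and> \<omega> i > 0"
    and min: "is_arg_min (heron_waist_objective m \<rho> \<omega>) (\<lambda>p. p \<in> feasible_set m C S) (c, z)"
    and i: "i \<in> {1..m}"
  shows "c i \<notin> interior (C i)"
proof
  assume int: "c i \<in> interior (C i)"
  define H where "H = convex hull (insert z (c ` ({1..m} - {i})))"
  have feas: "(c, z) \<in> feasible_set m C S"
    using min by (simp add: is_arg_min_def)
  have "c i \<notin> H"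
    unfolding H_def using general_position_vertex_notin_hull[OF gp i feas] .
  moreover have "closed H" "convex H"
    unfolding H_def by (auto intro!: compact_imp_closed finite_imp_compact_convex_hull)
  ultimately obtain u where u: "u \<in> C i" "\<And>w. w \<in> H \<Longrightarrow> norm (u - w) < norm (c i - w)"
    using interior_point_moves_nearer[OF int] by metis
  have zH: "z \<in> H"
    unfolding H_def by (simp add: hull_inc)
  have cH: "c j \<in> H" if "j \<in> {1..m}" "j \<noteq> i" for j
    unfolding H_def using that by (simp add: hull_inc)
  define d where "d = c(i := u)"
  have "(d, z) \<in> feasible_set m C S"
    using feas u(1) i by (auto simp: d_def mem_feasible_set_iff PiE_iff extensional_def)
  then have le: "heron_waist_objective m \<rho> \<omega> (c, z) \<le> heron_waist_objective m \<rho> \<omega> (d, z)"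
    using min by (auto simp: is_arg_min_linorder)
  have edge: "norm (d j - d (next_vertex m j)) \<le> norm (c j - c (next_vertex m j))"
    if "j \<in> {1..m}" for j
  proof -
    have nxt: "next_vertex m j \<in> {1..m}" "next_vertex m j \<noteq> j"
      using next_vertex_in_range[OF that] next_vertex_neq[OF m] by auto
    consider "j = i" | "next_vertex m j = i" "j \<noteq> i" | "j \<noteq> i" "next_vertex m j \<noteq> i"
      by blast
    then show ?thesis
    proof cases
      case 1
      then show ?thesis
        using u(2)[OF cH[OF nxt(1)]] nxt(2) by (simp add: d_def)
    next
      case 2
      then show ?thesis
        using u(2)[OF cH[OF that]] by (simp add: d_def norm_minus_commute)
    next
      case 3
      then show ?thesis
        by (simp add: d_def)
    qed
  qed
  have "(\<Sum>j=1..m. \<rho> j * norm (d j - d (next_vertex m j)))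
      \<le> (\<Sum>j=1..m. \<rho> j * norm (c j - c (next_vertex m j)))"
    using edge pos by (intro sum_mono mult_left_mono) (auto simp: less_imp_le)
  moreover have "(\<Sum>j=1..m. \<omega> j * norm (d j - z)) < (\<Sum>j=1..m. \<omega> j * norm (c j - z))"
  proof (rule sum_strict_mono_ex1)
    show "\<forall>j\<in>{1..m}. \<omega> j * norm (d j - z) \<le> \<omega> j * norm (c j - z)"
      using pos u(2)[OF zH] by (auto simp: d_def less_imp_le)
    show "\<exists>j\<in>{1..m}. \<omega> j * norm (d j - z) < \<omega> j * norm (c j - z)"
      using pos u(2)[OF zH] i by (intro bexI[of _ i]) (auto simp: d_def)
  qed simp
  ultimately show False
    using le by (simp add: heron_waist_objective_def)
qed

lemma norm_midpoint_diff:
  fixes a b x y :: "'a::real_normed_vector"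
  shows "norm (midpoint a b - midpoint x y) = norm ((a - x) + (b - y)) / 2"
proof -
  have "midpoint a b - midpoint x y = (1/2) *\<^sub>R ((a - x) + (b - y))"
    by (simp add: midpoint_def algebra_simps)
  then show ?thesis
    by simp
qed

text \<open>
  Each term of the objective is convex, so its value at the midpoint is at most the mean of the two
  values.  As the mean of the two objectives is already minimal, no term with a positive weight can
  fall below its mean.
\<close>
lemma minimizer_midpoint:
  fixes C :: "nat \<Rightarrow> (real ^ 'n) set"
  assumes C: "\<forall>i\<in>{1..m}. strictly_convex (C i)" and S: "strictly_convex S"
    and pos: "\<forall>i\<in>{1..m}. \<rho> i > 0 \<and> \<omega> i > 0"
    and p: "is_arg_min (heron_waist_objective m \<rho> \<omega>) (\<lambda>p. p \<in> feasible_set m C S) (a, x)"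
    and q: "is_arg_min (heron_waist_objective m \<rho> \<omega>) (\<lambda>p. p \<in> feasible_set m C S) (b, y)"
  shows "is_arg_min (heron_waist_objective m \<rho> \<omega>) (\<lambda>p. p \<in> feasible_set m C S)
      (\<lambda>i\<in>{1..m}. midpoint (a i) (b i), midpoint x y)" (is ?min)
    and "\<forall>i\<in>{1..m}. norm ((a i - x) + (b i - y)) = norm (a i - x) + norm (b i - y)" (is ?eq)
proof -
  let ?J = "heron_waist_objective m \<rho> \<omega> :: (nat \<Rightarrow> real ^ 'n) \<times> (real ^ 'n) \<Rightarrow> real"
  define c where "c = (\<lambda>i\<in>{1..m}. midpoint (a i) (b i))"
  have pfeas: "(a, x) \<in> feasible_set m C S" and qfeas: "(b, y) \<in> feasible_set m C S"
    using p q by (auto simp: is_arg_min_def)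
  have feas: "(c, midpoint x y) \<in> feasible_set m C S"
    using pfeas qfeas C S
    by (auto simp: c_def mem_feasible_set_iff PiE_iff intro!: strictly_convex_midpoint)
  have eqJ: "?J (b, y) = ?J (a, x)"
    using p q pfeas qfeas by (intro antisym) (auto simp: is_arg_min_linorder)
  have ge: "?J (a, x) \<le> ?J (c, midpoint x y)"
    using p feas by (auto simp: is_arg_min_linorder)
  define E where "E a = (\<Sum>i=1..m. \<rho> i * norm (a i - a (next_vertex m i)))" for a :: "nat \<Rightarrow> real ^ 'n"
  define W where "W a x = (\<Sum>i=1..m. \<omega> i * norm (a i - x))" for a :: "nat \<Rightarrow> real ^ 'n" and x
  have J: "?J (a, x) = E a + W a x" for a x
    by (simp add: heron_waist_objective_def E_def W_def)
  have E: "E c \<le> (E a + E b) / 2"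
  proof -
    have "E c \<le> (\<Sum>i=1..m. (\<rho> i * norm (a i - a (next_vertex m i))
        + \<rho> i * norm (b i - b (next_vertex m i))) / 2)"
      unfolding E_def
    proof (rule sum_mono)
      fix i assume i: "i \<in> {1..m}"
      have "norm (c i - c (next_vertex m i))
          \<le> (norm (a i - a (next_vertex m i)) + norm (b i - b (next_vertex m i))) / 2"
        using i next_vertex_in_range[OF i] norm_triangle_ineq
        by (simp add: c_def norm_midpoint_diff divide_right_mono)
      then have "\<rho> i * norm (c i - c (next_vertex m i))
          \<le> \<rho> i * ((norm (a i - a (next_vertex m i)) + norm (b i - b (next_vertex m i))) / 2)"
        using pos i by (intro mult_left_mono) (auto simp: less_imp_le)
      then show "\<rho> i * norm (c i - c (next_vertex m i)) \<le> (\<rho> i * norm (a i - a (next_vertex m i))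
        + \<rho> i * norm (b i - b (next_vertex m i))) / 2"
        by (simp add: algebra_simps)
    qed
    then show ?thesis
      by (simp add: E_def sum.distrib flip: sum_divide_distrib)
  qed
  have mean: "(W a x + W b y) / 2 = (\<Sum>i=1..m. \<omega> i * ((norm (a i - x) + norm (b i - y)) / 2))"
    by (simp add: W_def sum.distrib sum_divide_distrib distrib_left add_divide_distrib)
  have Wc: "W c (midpoint x y) = (\<Sum>i=1..m. \<omega> i * (norm ((a i - x) + (b i - y)) / 2))"
    unfolding W_def by (intro sum.cong) (simp_all add: c_def norm_midpoint_diff)
  have spoke_le: "\<omega> i * (norm ((a i - x) + (b i - y)) / 2)
      \<le> \<omega> i * ((norm (a i - x) + norm (b i - y)) / 2)" if "i \<in> {1..m}" for i
    using pos that norm_triangle_ineq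
    by (intro mult_left_mono divide_right_mono) (auto simp: less_imp_le)
  have W: "W c (midpoint x y) \<le> (W a x + W b y) / 2"
    unfolding mean Wc using spoke_le by (intro sum_mono)
  have "?J (c, midpoint x y) = ?J (a, x)"
    using E W ge eqJ by (simp add: J field_simps)
  then show ?min
    using p feas by (simp add: is_arg_min_linorder c_def)
  show ?eq
  proof (rule ccontr)
    assume "\<not> ?eq"
    then obtain k where k: "k \<in> {1..m}"
        "norm ((a k - x) + (b k - y)) < norm (a k - x) + norm (b k - y)"
      using norm_triangle_ineq by (metis order_le_imp_less_or_eq)
    have "W c (midpoint x y) < (W a x + W b y) / 2"
      unfolding mean Wc
    proof (rule sum_strict_mono_ex1)
      show "\<exists>i\<in>{1..m}. \<omega> i * (norm ((a i - x) + (b i - y)) / 2)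
          < \<omega> i * ((norm (a i - x) + norm (b i - y)) / 2)"
        using k pos by (intro bexI[of _ k]) auto
    qed (use spoke_le in auto)
    then show False
      using E ge eqJ by (simp add: J field_simps)
  qed
qed

lemma minimizers_same_vertices:
  fixes C :: "nat \<Rightarrow> (real ^ 'n) set"
  assumes m: "m \<ge> 2" and C: "\<forall>i\<in>{1..m}. strictly_convex (C i)" and S: "strictly_convex S"
    and gp: "general_position m C S" and pos: "\<forall>i\<in>{1..m}. \<rho> i > 0 \<and> \<omega> i > 0"
    and p: "is_arg_min (heron_waist_objective m \<rho> \<omega>) (\<lambda>p. p \<in> feasible_set m C S) (a, x)"
    and q: "is_arg_min (heron_waist_objective m \<rho> \<omega>) (\<lambda>p. p \<in> feasible_set m C S) (b, y)"
  shows "a = b"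
proof (rule PiE_ext)
  show a: "a \<in> (\<Pi>\<^sub>E i\<in>{1..m}. C i)" and b: "b \<in> (\<Pi>\<^sub>E i\<in>{1..m}. C i)"
    using p q by (auto simp: is_arg_min_def mem_feasible_set_iff)
  fix i assume i: "i \<in> {1..m}"
  show "a i = b i"
  proof (rule ccontr)
    assume "a i \<noteq> b i"
    then have "midpoint (a i) (b i) \<in> interior (C i)"
      using a b C i by (intro strictly_convex_midpoint_interior) auto
    moreover have "(\<lambda>j\<in>{1..m}. midpoint (a j) (b j)) i \<notin> interior (C i)"
      using minimizer_vertex_notin_interior[OF m gp pos minimizer_midpoint(1)[OF C S pos p q] i] .
    ultimately show False
      using i by simp
  qed
qed

text \<open>
  A betweenness among three vertices would put one of them into the hull of the two others.  With
  only two vertices, and equal spoke weights, the hub could slide along the segment joining them.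
\<close>
lemma general_position_not_collinear:
  assumes "m \<ge> 3" "general_position m C S" "(a, x) \<in> feasible_set m C S"
  shows "\<not> collinear (a ` {1..m})"
proof
  assume "collinear (a ` {1..m})"
  then have "collinear {a 1, a 2, a 3}"
    by (rule collinear_subset) (use assms(1) in auto)
  then consider "between (a 2, a 3) (a 1)" | "between (a 3, a 1) (a 2)" | "between (a 1, a 2) (a 3)"
    unfolding collinear_between_cases by blast
  moreover have "\<not> between (a j, a k) (a i)"
    if ijk: "i \<in> {1..m}" "j \<in> {1..m} - {i}" "k \<in> {1..m} - {i}" for i j k
  proof
    assume "between (a j, a k) (a i)"
    then have "a i \<in> convex hull {a j, a k}"
      by (simp add: between_mem_segment segment_convex_hull)
    also have "\<dots> \<subseteq> convex hull (insert x (a ` ({1..m} - {i})))"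
      using ijk by (intro hull_mono) blast
    finally show False
      using general_position_vertex_notin_hull[OF assms(2) ijk(1) assms(3)] by contradiction
  qed
  ultimately show False
    using assms(1) by cases simp_all
qed

theorem theorem3p6:
  fixes m :: nat
    and C :: "nat \<Rightarrow> (real ^ 'n) set"
    and S :: "(real ^ 'n) set"
    and \<rho> \<omega> :: "nat \<Rightarrow> real"
  assumes "m \<ge> 3"
    and "\<forall>i\<in>{1..m}. C i \<noteq> {} \<and> closed (C i) \<and> strictly_convex (C i)"
    and "S \<noteq> {}" and "closed S" and "strictly_convex S"
    and "general_position m C S"
    and "(\<exists>i\<in>{1..m}. bounded (C i)) \<or> bounded S"
    and "\<forall>i\<in>{1..m}. \<rho> i > 0 \<and> \<omega> i > 0"
  shows "\<exists>!p. is_arg_min (heron_waist_objective m \<rho> \<omega>) (\<lambda>p. p \<in> feasible_set m C S) p"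
proof (rule ex_ex1I)
  show "\<exists>p. is_arg_min (heron_waist_objective m \<rho> \<omega>) (\<lambda>p. p \<in> feasible_set m C S) p"
    using assms by (intro heron_waist_minimizer_exists) auto
next
  fix p q
  assume min: "is_arg_min (heron_waist_objective m \<rho> \<omega>) (\<lambda>p. p \<in> feasible_set m C S) p"
    "is_arg_min (heron_waist_objective m \<rho> \<omega>) (\<lambda>p. p \<in> feasible_set m C S) q"
  obtain a x b y where pq: "p = (a, x)" "q = (b, y)"
    by (cases p, cases q)
  note min = min[unfolded pq]
  have C: "\<forall>i\<in>{1..m}. strictly_convex (C i)"
    using assms(2) by blast
  have "a = b"
    using minimizers_same_vertices[OF _ C assms(5,6,8) min] assms(1) by simp
  have "x = y"
  proof (rule ccontr)
    assume "x \<noteq> y"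
    have "a i \<in> affine hull {x, y}" if "i \<in> {1..m}" for i
      using minimizer_midpoint(2)[OF C assms(5,8) min] that \<open>a = b\<close> \<open>x \<noteq> y\<close>
      by (intro norm_triangle_eq_imp_on_line) auto
    then have "collinear (a ` {1..m})"
      unfolding collinear_affine_hull by blast
    moreover have "(a, x) \<in> feasible_set m C S"
      using min(1) by (simp add: is_arg_min_def)
    ultimately show False
      using general_position_not_collinear[OF assms(1,6)] by blast
  qed
  with \<open>a = b\<close> show "p = q"
    by (simp add: pq)
qed

end
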